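(* Let $C$ be a ternary linear $[n,k,d]$ code with dual code $C^{\perp}$ of minimum weight $d^{\perp}$. Let $d_1=d<d_2<d_3$ denote the first, second and third smallest nonzero weights of $C$ (whenever they exist). Suppose $t\in\mathbb{N}$ satisfies the AM-condition $$d^{\perp}-t=\#\{u \mid C_u\neq\emptyset,\ 0<u\leq n-t\},$$ where $C_u=\{c\in C\mid \mathrm{wt}(c)=u\}$. For $\ell=1,2,3$ put $\alpha_\ell=n-d_\ell-(t+1)$ and $\beta_\ell=d_\ell-(t+1)$, and for $w\in\mathbb{N}$ write $$P_\ell(w)=\sum_{i+j=w} 2^{i}\binom{\alpha_\ell}{i}(-1)^{j}\binom{\beta_\ell}{j},$$ the sum running over nonnegative integers $i,j$ with $i+j=w$. For a weight $v$, let $D^{\perp}_v$ denote the support design of $C^{\perp}$ of weight $v$, i.e. the collection (repeated blocks allowed) of supports of the codewords of weight $v$ in $C^{\perp}$, and $C^{\perp}_v$ the set of codewords of weight $v$ in $C^{\perp}$. Then: (1) If $d^{\perp}-t=1$ and $w\in\mathbb{N}$ satisfies $P_1(w)=0$, then $D^{\perp}_{w+t+1}$ is a $(t+1)$-design provided $C^{\perp}_{w+t+1}$ is non-empty. (2) If $d^{\perp}-t=2$ and $w\in\mathbb{N}$ satisfies $P_1(w)-P_2(w)=0$, then $D^{\perp}_{w+t+1}$ is a $(t+1)$-design provided $C^{\perp}_{w+t+1}$ is non-empty. (3) If $d^{\perp}-t=3$ and $w\in\mathbb{N}$ satisfies $$P_1(w)-\frac{d_3-d_1}{d_3-d_2}P_2(w)+\frac{d_2-d_1}{d_3-d_2}P_3(w)=0,$$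 then $D^{\perp}_{w+t+1}$ is a $(t+1)$-design provided $C^{\perp}_{w+t+1}$ is non-empty.
   Context: A ternary $[n,k,d]$ code is a $k$-dimensional subspace of $\mathbb{F}_3^n$ with minimum nonzero Hamming weight $d$. $C^{\perp}$ is the dual of $C$ with respect to the standard inner product on $\mathbb{F}_3^n$. Combinatorial $t$-designs are allowed to have repeated blocks. Under the AM-condition, the Assmus--Mattson theorem gives that all support designs of $C$ and $C^{\perp}$ are $t$-designs. *)

theory Defs
  imports "HOL-Analysis.Cartesian_Space" "HOL-Library.Multiset"
begin

definition support :: "'a::zero ^ 'n \<Rightarrow> 'n set" where
  "support c = {i. c $ i \<noteq> 0}"

definition wt :: "'a::zero ^ 'n \<Rightarrow> nat" where
  "wt c = card (support c)"

definition nonzero_weights :: "('a::zero ^ 'n) set \<Rightarrow> nat set" where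
  "nonzero_weights C = wt ` (C - {0})"

definition is_min_weight :: "('a::zero ^ 'n) set \<Rightarrow> nat \<Rightarrow> bool" where
  "is_min_weight C d \<longleftrightarrow> d \<in> nonzero_weights C \<and> (\<forall>u\<in>nonzero_weights C. d \<le> u)"

text \<open>
  The field \<open>\<F>\<^sub>3\<close> is represented by an arbitrary field type with three elements, and
  \<open>\<F>\<^sub>3\<close>-vectors of length \<open>n\<close> by vectors over an index type with \<open>n\<close> elements.
\<close>

definition ternary_code :: "('a::field ^ 'n) set \<Rightarrow> nat \<Rightarrow> nat \<Rightarrow> nat \<Rightarrow> bool" where
  "ternary_code C n k d \<longleftrightarrow>
     CARD('a) = 3 \<and> CARD('n) = n \<and> vec.subspace C \<and> vec.dim C = k \<and> is_min_weight C d"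

definition dual_code :: "('a::field ^ 'n) set \<Rightarrow> ('a ^ 'n) set" where
  "dual_code C = {x. \<forall>c\<in>C. (\<Sum>i\<in>UNIV. x $ i * c $ i) = 0}"

definition codewords :: "('a::zero ^ 'n) set \<Rightarrow> nat \<Rightarrow> ('a ^ 'n) set" where
  "codewords C u = {c \<in> C. wt c = u}"

text \<open>
  The \<open>l\<close>-th smallest nonzero weight, counted from \<open>l = 1\<close>; it is meaningful only for
  \<open>1 \<le> l \<le> card (nonzero_weights C)\<close>.
\<close>

definition nth_weight :: "('a::zero ^ 'n) set \<Rightarrow> nat \<Rightarrow> nat" where
  "nth_weight C l = sorted_list_of_set (nonzero_weights C) ! (l - 1)"

lemma nth_weight_1:
  fixes C :: "('a::zero ^ 'n) set"
  assumes "is_min_weight C d"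
  shows "nth_weight C 1 = d"
proof -
  have "nonzero_weights C \<subseteq> {..CARD('n)}"
    by (auto simp: nonzero_weights_def wt_def intro: card_mono)
  then have fin: "finite (nonzero_weights C)"
    by (rule finite_subset) simp
  have ne: "nonzero_weights C \<noteq> {}"
    using assms by (auto simp: is_min_weight_def)
  have "Min (nonzero_weights C) = d"
    using assms fin by (auto simp: is_min_weight_def intro: Min_eqI)
  then show ?thesis
    using sorted_list_of_set_nonempty[OF fin ne] by (simp add: nth_weight_def)
qed

definition AM_condition :: "('a::field ^ 'n) set \<Rightarrow> nat \<Rightarrow> nat \<Rightarrow> bool" where
  "AM_condition C dperp t \<longleftrightarrow>
     int dperp - int t =
       int (card {u. codewords C u \<noteq> {} \<and> 0 < u \<and> int u \<le> int CARD('n) - int t})"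

text \<open>
  A \<open>t\<close>-\<open>(v, k, \<lambda>)\<close> design on the point set \<open>X\<close> with \<open>v = card X\<close>. Blocks form a multiset,
  so that repeated blocks are counted with multiplicity.
\<close>

definition is_t_design_with :: "nat \<Rightarrow> nat \<Rightarrow> nat \<Rightarrow> 'p set \<Rightarrow> 'p set multiset \<Rightarrow> bool" where
  "is_t_design_with t k lam X B \<longleftrightarrow>
     finite X \<and> t \<le> k \<and> k \<le> card X \<and> 0 < lam \<and>
     (\<forall>b\<in>#B. b \<subseteq> X \<and> card b = k) \<and>
     (\<forall>T. T \<subseteq> X \<and> card T = t \<longrightarrow> size {#b \<in># B. T \<subseteq> b#} = lam)"

definition is_t_design :: "nat \<Rightarrow> 'p set \<Rightarrow> 'p set multiset \<Rightarrow> bool" where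
  "is_t_design t X B \<longleftrightarrow> (\<exists>k lam. is_t_design_with t k lam X B)"

definition support_design :: "('a::{zero,finite} ^ 'n) set \<Rightarrow> nat \<Rightarrow> 'n set multiset" where
  "support_design C u = image_mset support (mset_set (codewords C u))"

text \<open>
  \<open>P_coeff \<alpha> \<beta> w\<close> is the coefficient of \<open>y ^ w\<close> in \<open>(1 + 2 y) ^ \<alpha> (1 - y) ^ \<beta>\<close>. The exponents
  are integers because \<open>n - d\<^sub>l - (t + 1)\<close> and \<open>d\<^sub>l - (t + 1)\<close> can be negative; for
  nonnegative arguments the generalized binomial coefficient is the ordinary one.
\<close>

definition P_coeff :: "int \<Rightarrow> int \<Rightarrow> nat \<Rightarrow> real" where
  "P_coeff \<alpha> \<beta> w =
     (\<Sum>(i, j) \<in> {(i, j). i + j = w}.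
        2 ^ i * (of_int \<alpha> gchoose i) * (- 1) ^ j * (of_int \<beta> gchoose j))"

end

theory Submission
  imports Defs "HOL-Computational_Algebra.Polynomial"
begin

text \<open>
  Write \<open>N\<^sub>u(S)\<close> for the number of codewords of weight \<open>u\<close> in \<open>C\<close> whose support contains \<open>S\<close>. Poisson
  summation expresses the enumerator of the dual codewords covering \<open>S\<close> through the numbers
  \<open>N\<^sub>u(V)\<close> with \<open>V \<subseteq> S\<close>. If \<open>N\<^sub>u\<close> depends only on the size for sets smaller than \<open>m\<close>, then for
  \<open>card S = card S' = m\<close> the two enumerators differ by a multiple of
  \<open>\<Sum>\<^sub>u \<delta>\<^sub>u (1 + 2 y) ^ (n - m - u) (1 - y) ^ (u - m)\<close> with \<open>\<delta>\<^sub>u = N\<^sub>u(S) - N\<^sub>u(S')\<close> and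
  \<open>m \<le> u \<le> n - m\<close>. This difference vanishes to order \<open>d\<^sup>\<bottom> - m\<close> at \<open>y = 0\<close>, which is equivalent to
  \<open>\<Sum>\<^sub>u \<delta>\<^sub>u u ^ j = 0\<close> for \<open>j < d\<^sup>\<bottom> - m\<close>. For \<open>m \<le> t\<close> there are at most \<open>d\<^sup>\<bottom> - m\<close> weights, so
  \<open>\<delta> = 0\<close> by a Vandermonde argument. For \<open>m = t + 1\<close> there may be one weight too many, \<open>\<delta>\<close> is
  determined up to a factor, and the hypothesis on \<open>w\<close> says that the coefficient of \<open>y ^ w\<close> vanishes.
\<close>

section \<open>Kernel polynomials and the moments of their combinations\<close>

text \<open>The generating function of the ternary Krawtchouk polynomials of length
  \<open>a + b\<close> at the point \<open>b\<close>: in the MacWilliams transform, each of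
  \<open>a\<close> zero entries contributes \<open>1 + 2 y\<close> and each of \<open>b\<close>
  nonzero entries \<open>1 - y\<close>.\<close>

definition krawtchouk_poly :: "nat \<Rightarrow> nat \<Rightarrow> real poly" where
  "krawtchouk_poly a b = [:1, 2:] ^ a * [:1, - 1:] ^ b"

lemma poly_krawtchouk_poly: "poly (krawtchouk_poly a b) y = (1 + 2 * y) ^ a * (1 - y) ^ b"
  by (simp add: krawtchouk_poly_def algebra_simps)

lemma coeff_krawtchouk_poly: "coeff (krawtchouk_poly a b) w = P_coeff (int a) (int b) w"
proof -
  \<comment> \<open>For \<open>i > k\<close> both sides are 0, so no bound on \<open>i\<close> is
    required.\<close>
  have lin: "coeff ([:1, c:] ^ k) i = c ^ i * (of_nat k gchoose i)" for c :: real and k i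
  proof (cases "i \<le> k")
    case True
    then show ?thesis by (simp add: coeff_linear_poly_power binomial_gbinomial)
  next
    case False
    have "degree ([:1, c:] ^ k) \<le> k"
      using degree_power_le[of "[:1, c:]" k] by (auto split: if_splits)
    with False show ?thesis
      by (simp add: coeff_eq_0 binomial_gbinomial[symmetric])
  qed
  have pairs: "{(i, j). i + j = w} = (\<lambda>i. (i, w - i)) ` {..w}" by force
  have inj: "inj_on (\<lambda>i. (i, w - i)) {..w}" by (auto simp: inj_on_def)
  show ?thesis
    unfolding krawtchouk_poly_def coeff_mult P_coeff_def pairs sum.reindex[OF inj]
    by (intro sum.cong) (simp_all add: lin)
qed

lemma pderiv_sum: "pderiv (\<Sum>i\<in>I. f i) = (\<Sum>i\<in>I. pderiv (f i))"
  by (induction I rule: infinite_finite_induct) (simp_all add: pderiv_add)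

text \<open>
  The kernels \<open>(1 + 2 y) ^ a (1 - y) ^ b\<close> with \<open>a + b\<close> fixed are eigenvectors of one first-order
  operator. Applying it lowers the order of vanishing at \<open>y = 0\<close> by at most one and multiplies
  the coefficient of the \<open>u\<close>-th kernel by \<open>- 3 u\<close>.
\<close>

lemma krawtchouk_poly_eigenvector:
  assumes "m \<le> u" "u + m \<le> n"
  shows "[:1, 1, - 2:] * pderiv (krawtchouk_poly (n - m - u) (u - m))
       - [:2 * real (n - 2 * m) + 3 * real m, - 2 * real (n - 2 * m):]
           * krawtchouk_poly (n - m - u) (u - m)
       = smult (- 3 * real u) (krawtchouk_poly (n - m - u) (u - m))"
proof -
  obtain a where a: "n = a + u + m"
    using assms(2) by (metis add.assoc add.commute le_Suc_ex)
  obtain b where b: "u = b + m"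
    using assms(1) by (metis add.commute le_Suc_ex)
  have p: "[:1, 2:] * pderiv ([:1, 2:] ^ a) = smult (2 * real a) ([:1, 2 :: real:] ^ a)"
    by (cases a) (simp_all add: pderiv_power_Suc pderiv_pCons del: power_Suc, simp add: mult_ac)
  have q: "[:1, - 1:] * pderiv ([:1, - 1:] ^ b) = smult (- real b) ([:1, - 1 :: real:] ^ b)"
    by (cases b) (simp_all add: pderiv_power_Suc pderiv_pCons del: power_Suc, simp add: mult_ac)
  define A where "A = [:1, 2 :: real:] ^ a"
  define B where "B = [:1, - 1 :: real:] ^ b"
  have f: "[:1, 1, - 2 :: real:] = [:1, 2:] * [:1, - 1:]" by simp
  have "[:1, 1, - 2:] * pderiv (A * B)
      = ([:1, - 1:] * B) * ([:1, 2:] * pderiv A) + ([:1, 2:] * A) * ([:1, - 1:] * pderiv B)"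
    unfolding f pderiv_mult by algebra
  also have "\<dots> = ([:1, - 1:] * B) * smult (2 * real a) A
      + ([:1, 2:] * A) * smult (- real b) B"
    using p q by (simp only: A_def B_def)
  also have "\<dots> = [:2 * real a - real b, - 2 * real a - 2 * real b:] * (A * B)"
  proof -
    have s: "smult c p = [:c:] * p" for c and p :: "real poly" by simp
    have e: "[:2 * real a - real b, - 2 * real a - 2 * real b:]
        = [:1, - 1:] * [:2 * real a:] + [:1, 2:] * [:- real b:]" by simp
    show ?thesis unfolding s e by algebra
  qed
  finally have L: "[:1, 1, - 2:] * pderiv (A * B)
      = [:2 * real a - real b, - 2 * real a - 2 * real b:] * (A * B)" .
  have k: "krawtchouk_poly (n - m - u) (u - m) = A * B"
    by (simp add: krawtchouk_poly_def A_def B_def a b)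
  \<comment> \<open>Here \<open>a + b = n - 2 m\<close> and \<open>b = u - m\<close>, so
    \<open>2 a - b = 2 (n - 2 m) + 3 m - 3 u\<close>. All dependence on \<open>u\<close> is in the
    eigenvalue.\<close>
  have c: "[:2 * real a - real b, - 2 * real a - 2 * real b:]
     - [:2 * real (n - 2 * m) + 3 * real m, - 2 * real (n - 2 * m):] = [:- 3 * real u:]"
    by (simp add: a b)
  show ?thesis
    unfolding k L left_diff_distrib[symmetric] c by simp
qed

text \<open>Every kernel has constant coefficient 1, so coefficient 0 of the combination is the
  zeroth moment. The eigenvector equation replaces the weights \<open>\<delta> u\<close> by
  \<open>- 3 u \<delta> u\<close>, which raises the moment by one and costs one order of vanishing.
  Hence the induction varies both \<open>r\<close> and \<open>\<delta>\<close>.\<close>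

lemma moments_eq_0:
  fixes \<delta> :: "nat \<Rightarrow> real"
  assumes "\<And>u. u \<in> U \<Longrightarrow> m \<le> u \<and> u + m \<le> n"
    and "\<And>i. i < r \<Longrightarrow> coeff (\<Sum>u\<in>U. smult (\<delta> u) (krawtchouk_poly (n - m - u) (u - m))) i = 0"
    and "j < r"
  shows "(\<Sum>u\<in>U. \<delta> u * real u ^ j) = 0"
  using assms(2,3)
proof (induction j arbitrary: r \<delta>)
  case 0
  have "coeff (krawtchouk_poly a b) 0 = 1" for a b
    by (simp add: poly_0_coeff_0[symmetric] poly_krawtchouk_poly)
  with 0(1)[of 0] 0(2) show ?case
    by (simp add: coeff_sum)
next
  case (Suc j)
  let ?K = "\<lambda>u. krawtchouk_poly (n - m - u) (u - m)"
  let ?c = "[:2 * real (n - 2 * m) + 3 * real m, - 2 * real (n - 2 * m):]"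
  define p where "p = (\<Sum>u\<in>U. smult (\<delta> u) (?K u))"
  have "(\<Sum>u\<in>U. smult (- 3 * (\<delta> u * real u)) (?K u))
      = (\<Sum>u\<in>U. smult (\<delta> u) (smult (- 3 * real u) (?K u)))"
    by (intro sum.cong) (simp_all add: mult_ac)
  also have "\<dots> = (\<Sum>u\<in>U. smult (\<delta> u) ([:1, 1, - 2:] * pderiv (?K u) - ?c * ?K u))"
    using assms(1) by (intro sum.cong refl arg_cong[where f = "smult _"])
      (metis krawtchouk_poly_eigenvector)
  also have "\<dots> = [:1, 1, - 2:] * pderiv p - ?c * p"
    unfolding p_def pderiv_sum pderiv_smult
    by (simp only: smult_diff_right mult_smult_right[symmetric] sum_subtractf sum_distrib_left)
  finally have D: "(\<Sum>u\<in>U. smult (- 3 * (\<delta> u * real u)) (?K u))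
      = [:1, 1, - 2:] * pderiv p - ?c * p" .
  have low: "coeff p i = 0" if "i < r" for i
    using Suc.prems(1)[OF that] by (simp add: p_def)
  \<comment> \<open>The bound drops to \<open>r - 1\<close> because coefficient \<open>i\<close> of
    the derivative involves coefficient \<open>i + 1\<close> of \<open>p\<close>.\<close>
  have "coeff (\<Sum>u\<in>U. smult (\<delta> u * real u) (?K u)) i = 0" if "i < r - 1" for i
  proof -
    have "coeff ([:1, 1, - 2:] * pderiv p) i = 0" "coeff (?c * p) i = 0"
      unfolding coeff_mult coeff_pderiv using that low by (intro sum.neutral; simp)+
    then have "coeff ([:1, 1, - 2:] * pderiv p - ?c * p) i = 0"
      unfolding coeff_diff by simp
    then show ?thesis
      unfolding D[symmetric] by (simp add: coeff_sum mult.assoc sum_negf sum_distrib_left[symmetric])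
  qed
  then have "(\<Sum>u\<in>U. \<delta> u * real u * real u ^ j) = 0"
    using Suc.IH[of "r - 1" "\<lambda>u. \<delta> u * real u"] Suc.prems(2) by auto
  then show ?case by (simp add: mult_ac)
qed

text \<open>Pair \<open>\<delta>\<close> with the polynomial \<open>g\<close> whose roots are the
  points of \<open>U\<close> other than \<open>v\<close>. Its degree is
  \<open>card U - 1 < r\<close>, so the moments kill the pairing, while only the term at
  \<open>v\<close> survives in it.\<close>

lemma eq_0_if_moments_eq_0:
  fixes \<delta> :: "nat \<Rightarrow> real"
  assumes "finite U" "card U \<le> r"
    and mom: "\<And>j. j < r \<Longrightarrow> (\<Sum>u\<in>U. \<delta> u * real u ^ j) = 0"
    and "v \<in> U"
  shows "\<delta> v = 0"
proof -
  define g :: "real poly" where "g = (\<Prod>b\<in>U - {v}. [:- real b, 1:])"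
  have "degree g = card (U - {v})"
    unfolding g_def by (subst degree_prod_eq_sum_degree) auto
  then have deg: "degree g < r"
    using assms card_gt_0_iff[of U] by (auto simp: card_Diff_singleton)
  have pg: "poly g x = (\<Prod>b\<in>U - {v}. x - real b)" for x
    by (simp add: g_def poly_prod)
  have "(\<Sum>u\<in>U. \<delta> u * poly g (real u))
      = (\<Sum>j\<le>degree g. coeff g j * (\<Sum>u\<in>U. \<delta> u * real u ^ j))"
    unfolding poly_altdef sum_distrib_left by (subst sum.swap) (simp add: mult_ac)
  also have "\<dots> = 0"
    using deg mom by (intro sum.neutral) auto
  finally have "(\<Sum>u\<in>U. \<delta> u * poly g (real u)) = 0" .
  moreover have "(\<Sum>u\<in>U. \<delta> u * poly g (real u)) = (\<Sum>u\<in>{v}. \<delta> u * poly g (real u))"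
    using assms by (intro sum.mono_neutral_right) (auto simp: pg)
  ultimately have "\<delta> v * poly g (real v) = 0" by simp
  moreover have "poly g (real v) \<noteq> 0"
    using assms by (auto simp: pg)
  ultimately show ?thesis by simp
qed

section \<open>Characters of the field with three elements and Poisson summation\<close>

lemma ternary_UNIV:
  assumes "CARD('a::{field,finite}) = 3"
  shows "(UNIV :: 'a set) = {0, 1, - 1}" "(1 :: 'a) \<noteq> - 1" "(1 :: 'a) + 1 = - 1"
proof -
  have three: "(1 :: 'a) + 1 + 1 = 0"
  proof -
    \<comment> \<open>Translation by 1 permutes the field. Comparing the sums of all elements shows
      that the field's cardinality is 0 in the field.\<close>
    have "(\<Sum>x\<in>UNIV. x + 1) = (\<Sum>x\<in>(UNIV :: 'a set). x)"
      by (rule sum.reindex_bij_witness[where i = "\<lambda>x. x - 1" and j = "\<lambda>x. x + 1"]) auto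
    then have "(of_nat CARD('a) :: 'a) = 0"
      by (simp add: sum.distrib)
    then show ?thesis using assms by (simp add: numeral_eq_Suc add.assoc)
  qed
  then show e: "(1 :: 'a) + 1 = - 1"
    using eq_neg_iff_add_eq_0 by blast
  show ne: "(1 :: 'a) \<noteq> - 1"
  proof
    assume "(1 :: 'a) = - 1"
    with e have "(1 :: 'a) + 1 = 1 + 0" by (metis add_0_right)
    then show False by (metis add_left_imp_eq one_neq_zero)
  qed
  have "card {0, 1, - 1 :: 'a} = CARD('a)"
    using ne assms by auto
  then show "(UNIV :: 'a set) = {0, 1, - 1}"
    by (metis card_subset_eq finite subset_UNIV)
qed

text \<open>On a field with three elements this is a nontrivial additive character: 1 goes to a
  primitive cube root of unity and the remaining element to its conjugate.\<close>

definition ternary_char :: "'a::field \<Rightarrow> complex" where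
  "ternary_char a = (if a = 0 then 1 else if a = 1 then Complex (- 1 / 2) (sqrt 3 / 2)
     else Complex (- 1 / 2) (- sqrt 3 / 2))"

lemma ternary_char_0 [simp]: "ternary_char 0 = 1"
  by (simp add: ternary_char_def)

lemma ternary_char_eq_1_iff: "ternary_char a = 1 \<longleftrightarrow> a = 0"
  by (auto simp: ternary_char_def complex_eq_iff)

lemma ternary_char_add:
  assumes "CARD('a::{field,finite}) = 3"
  shows "ternary_char (a + b :: 'a) = ternary_char a * ternary_char b"
proof -
  note U = ternary_UNIV[OF assms]
  have two: "(2 :: 'a) = - 1" using U(3) by (metis one_add_one)
  have ne: "- 1 \<noteq> (1 :: 'a)" using U(2) by metis
  have "a \<in> {0, 1, - 1}" "b \<in> {0, 1, - 1}" using U(1) by auto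
  then show ?thesis
    using U(2) ne by (elim insertE emptyE)
      (simp_all add: ternary_char_def complex_eq_iff two)
qed

lemma ternary_char_sum:
  assumes "CARD('a::{field,finite}) = 3"
  shows "ternary_char (\<Sum>i\<in>I. f i :: 'a) = (\<Prod>i\<in>I. ternary_char (f i))"
  by (induction I rule: infinite_finite_induct) (simp_all add: ternary_char_add[OF assms])

text \<open>Orthogonality of characters: if \<open>x\<close> is not in the dual, some
  \<open>c0\<close> in \<open>C\<close> has character value different from 1, and translating the
  sum by \<open>c0\<close> multiplies it by that value, so it is 0.\<close>

lemma sum_ternary_char:
  fixes C :: "('a::{field,finite} ^ 'n) set"
  assumes "CARD('a) = 3" "vec.subspace C"
  shows "(\<Sum>c\<in>C. ternary_char (\<Sum>i\<in>UNIV. x $ i * c $ i))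
    = (if x \<in> dual_code C then of_nat (card C) else 0)"
proof (cases "x \<in> dual_code C")
  case True
  then show ?thesis by (simp add: dual_code_def)
next
  case False
  let ?f = "\<lambda>c. ternary_char (\<Sum>i\<in>UNIV. x $ i * c $ i)"
  obtain c0 where c0: "c0 \<in> C" "(\<Sum>i\<in>UNIV. x $ i * c0 $ i) \<noteq> 0"
    using False by (auto simp: dual_code_def)
  have "(\<Sum>c\<in>C. ?f c) = (\<Sum>c\<in>C. ?f (c + c0))"
    by (rule sum.reindex_bij_witness[where i = "\<lambda>c. c + c0" and j = "\<lambda>c. c - c0"])
      (use assms(2) c0 in \<open>auto intro: vec.subspace_add vec.subspace_diff\<close>)
  also have "\<dots> = ?f c0 * (\<Sum>c\<in>C. ?f c)"
    by (simp add: distrib_left sum.distrib ternary_char_add[OF assms(1)] sum_distrib_left mult.commute)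
  finally have "(?f c0 - 1) * (\<Sum>c\<in>C. ?f c) = 0" by (simp add: algebra_simps)
  moreover have "?f c0 \<noteq> 1" using c0 by (simp add: ternary_char_eq_1_iff)
  ultimately show ?thesis using False by simp
qed

text \<open>The product of the local Fourier transforms expands into a sum over all words
  \<open>x\<close>. After exchanging sums, orthogonality over \<open>C\<close> keeps exactly the
  words of the dual.\<close>

lemma poisson_summation:
  fixes C :: "('a::{field,finite} ^ 'n) set" and h :: "'n \<Rightarrow> 'a \<Rightarrow> complex"
  assumes "CARD('a) = 3" "vec.subspace C"
  shows "of_nat (card C) * (\<Sum>x\<in>dual_code C. \<Prod>i\<in>UNIV. h i (x $ i))
    = (\<Sum>c\<in>C. \<Prod>i\<in>UNIV. \<Sum>b\<in>UNIV. h i b * ternary_char (b * c $ i))"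
proof -
  have "(\<Prod>i\<in>UNIV. \<Sum>b\<in>UNIV. h i b * ternary_char (b * c $ i))
      = (\<Sum>x\<in>UNIV. (\<Prod>i\<in>UNIV. h i (x $ i)) * ternary_char (\<Sum>i\<in>UNIV. x $ i * c $ i))"
    for c :: "'a ^ 'n"
  proof -
    have "(\<Prod>i\<in>UNIV. \<Sum>b\<in>UNIV. h i b * ternary_char (b * c $ i))
        = (\<Sum>g\<in>UNIV. \<Prod>i\<in>UNIV. h i (g i) * ternary_char (g i * c $ i))"
      by (subst prod_sum_PiE) (auto simp: PiE_UNIV_domain)
    also have "\<dots> = (\<Sum>x\<in>UNIV. \<Prod>i\<in>UNIV. h i (x $ i) * ternary_char (x $ i * c $ i))"
      by (rule sum.reindex_bij_witness[where i = "vec_nth" and j = "vec_lambda"])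
        auto
    finally show ?thesis
      by (simp add: prod.distrib ternary_char_sum[OF assms(1)])
  qed
  then have "(\<Sum>c\<in>C. \<Prod>i\<in>UNIV. \<Sum>b\<in>UNIV. h i b * ternary_char (b * c $ i))
      = (\<Sum>x\<in>UNIV. (\<Prod>i\<in>UNIV. h i (x $ i)) * (\<Sum>c\<in>C. ternary_char (\<Sum>i\<in>UNIV. x $ i * c $ i)))"
    by (simp add: sum.swap[of _ C UNIV] sum_distrib_left)
  also have "\<dots> = (\<Sum>x\<in>UNIV. if x \<in> dual_code C then of_nat (card C) * (\<Prod>i\<in>UNIV. h i (x $ i)) else 0)"
    by (intro sum.cong) (simp_all add: sum_ternary_char[OF assms])
  also have "\<dots> = of_nat (card C) * (\<Sum>x\<in>dual_code C. \<Prod>i\<in>UNIV. h i (x $ i))"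
    by (simp add: sum.If_cases sum_distrib_left)
  finally show ?thesis by simp
qed

lemma macwilliams_covering:
  fixes C :: "('a::{field,finite} ^ 'n) set" and y :: real
  assumes "CARD('a) = 3" "vec.subspace C"
  shows "real (card C) * (\<Sum>x\<in>{x \<in> dual_code C. S \<subseteq> support x}. y ^ (wt x - card S))
    = (\<Sum>c\<in>C. \<Prod>i\<in>UNIV. if i \<in> S then (if c $ i = 0 then 2 else - 1)
         else (if c $ i = 0 then 1 + 2 * y else 1 - y))"
proof -
  note U = ternary_UNIV[OF assms(1)]
  \<comment> \<open>This test function forces a nonzero entry at each position of \<open>S\<close>
    and marks nonzero entries elsewhere by \<open>y\<close>.\<close>
  define h :: "'n \<Rightarrow> 'a \<Rightarrow> real"
    where "h i b = (if i \<in> S then (if b = 0 then 0 else 1) else (if b = 0 then 1 else y))" for i b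
  define k :: "'n \<Rightarrow> 'a \<Rightarrow> real"
    where "k i a = (if i \<in> S then (if a = 0 then 2 else - 1)
         else (if a = 0 then 1 + 2 * y else 1 - y))" for i a
  \<comment> \<open>The local Fourier transform of \<open>h\<close>, using that the character values
    at the two nonzero elements add up to -1.\<close>
  have hat: "(\<Sum>b\<in>UNIV. of_real (h i b) * ternary_char (b * a)) = of_real (k i a)" for i a
  proof -
    have "- 1 \<noteq> (1 :: 'a)" using U(2) by metis
    moreover have "a \<in> {0, 1, - 1}" using U(1) by auto
    ultimately show ?thesis
      using U(2) unfolding U(1)
      by (elim insertE emptyE)
        (simp_all add: h_def k_def ternary_char_def complex_eq_iff)
  qed
  have h: "(\<Prod>i\<in>UNIV. h i (x $ i)) = (if S \<subseteq> support x then y ^ (wt x - card S) else 0)" for x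
  proof (cases "S \<subseteq> support x")
    case True
    have "(\<Prod>i\<in>UNIV. h i (x $ i)) = (\<Prod>i\<in>support x - S. y)"
      using True by (intro prod.mono_neutral_cong_right) (auto simp: h_def support_def)
    with True show ?thesis by (simp add: wt_def card_Diff_subset)
  next
    case False
    then obtain i where "i \<in> S" "x $ i = 0" by (auto simp: support_def)
    then have "h i (x $ i) = 0" by (simp add: h_def)
    with False show ?thesis by (auto intro: prod_zero)
  qed
  have "of_real (real (card C) * (\<Sum>x\<in>dual_code C. \<Prod>i\<in>UNIV. h i (x $ i)))
      = (of_real (\<Sum>c\<in>C. \<Prod>i\<in>UNIV. k i (c $ i)) :: complex)"
    using poisson_summation[OF assms, of "\<lambda>i b. of_real (h i b)"] unfolding hat by simp
  then have "real (card C) * (\<Sum>x\<in>dual_code C. \<Prod>i\<in>UNIV. h i (x $ i))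
      = (\<Sum>c\<in>C. \<Prod>i\<in>UNIV. k i (c $ i))"
    by (simp only: of_real_eq_iff)
  then show ?thesis
    by (simp add: h k_def sum.If_cases Int_def)
qed

section \<open>Covering numbers and the dual enumerator\<close>

text \<open>Codewords are counted rather than their supports, which matches the multiplicities of
  repeated blocks in \<open>support_design\<close>.\<close>

definition cover_count :: "('a::zero ^ 'n) set \<Rightarrow> nat \<Rightarrow> 'n set \<Rightarrow> nat" where
  "cover_count C u V = card {c \<in> codewords C u. V \<subseteq> support c}"

definition dual_cover_poly :: "('a::field ^ 'n) set \<Rightarrow> 'n set \<Rightarrow> real poly" where
  "dual_cover_poly C S = (\<Sum>x\<in>{x \<in> dual_code C. S \<subseteq> support x}. monom 1 (wt x - card S))"

lemma card_le_wt: "V \<subseteq> support c \<Longrightarrow> card V \<le> wt c"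
  by (simp add: wt_def card_mono)

lemma coeff_dual_cover_poly:
  fixes C :: "('a::{field,finite} ^ 'n) set"
  shows "coeff (dual_cover_poly C S) w = real (cover_count (dual_code C) (w + card S) S)"
proof -
  have "coeff (dual_cover_poly C S) w
      = (\<Sum>x\<in>{x \<in> dual_code C. S \<subseteq> support x}. if wt x = w + card S then 1 else 0)"
    unfolding dual_cover_poly_def coeff_sum
    by (intro sum.cong refl) (auto dest: card_le_wt)
  also have "\<dots> = real (cover_count (dual_code C) (w + card S) S)"
    by (simp add: sum.If_cases cover_count_def codewords_def Int_def conj_ac)
  finally show ?thesis .
qed

text \<open>Expand the product by the set \<open>V\<close> of positions that contribute
  \<open>b\<close>. A codeword contributes to the term of \<open>V\<close> only if its support
  contains \<open>V\<close>, so exchanging sums produces covering numbers.\<close>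

lemma sum_codewords_prod:
  fixes C :: "('a::{zero,finite} ^ 'n) set" and a b :: real
  shows "(\<Sum>c\<in>codewords C u. \<Prod>i\<in>S. a + (if i \<in> support c then b else 0))
    = (\<Sum>V\<in>Pow S. a ^ (card S - card V) * b ^ card V * real (cover_count C u V))"
proof -
  have expand: "(\<Prod>i\<in>S. a + (if i \<in> R then b else 0))
      = (\<Sum>V\<in>Pow S. if V \<subseteq> R then a ^ (card S - card V) * b ^ card V else 0)" for R
  proof -
    have V: "(\<Prod>i\<in>V. if i \<in> R then b else 0) = (if V \<subseteq> R then b ^ card V else 0)" for V
    proof (cases "V \<subseteq> R")
      case True
      then have "(\<Prod>i\<in>V. if i \<in> R then b else 0) = (\<Prod>i\<in>V. b)"
        by (intro prod.cong) auto
      with True show ?thesis by simp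
    next
      case False
      then obtain i where "i \<in> V" "i \<notin> R" by auto
      with False show ?thesis by (auto intro!: prod_zero)
    qed
    have "(\<Prod>i\<in>S. a + (if i \<in> R then b else 0)) = (\<Prod>i\<in>S. (if i \<in> R then b else 0) + a)"
      by (simp add: add.commute)
    also have "\<dots> = (\<Sum>V\<in>Pow S. (if V \<subseteq> R then b ^ card V else 0) * a ^ card (S - V))"
      by (subst prod_add) (simp_all add: V)
    also have "\<dots> = (\<Sum>V\<in>Pow S. if V \<subseteq> R then a ^ (card S - card V) * b ^ card V else 0)"
      by (intro sum.cong) (auto simp: card_Diff_subset)
    finally show ?thesis .
  qed
  have "(\<Sum>c\<in>codewords C u. \<Prod>i\<in>S. a + (if i \<in> support c then b else 0))
      = (\<Sum>V\<in>Pow S. \<Sum>c\<in>codewords C u.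
          if V \<subseteq> support c then a ^ (card S - card V) * b ^ card V else 0)"
    unfolding expand by (rule sum.swap)
  also have "\<dots> = (\<Sum>V\<in>Pow S. a ^ (card S - card V) * b ^ card V * real (cover_count C u V))"
    by (intro sum.cong refl) (simp add: sum.If_cases cover_count_def Int_def mult.commute)
  finally show ?thesis .
qed

text \<open>A bijection from \<open>S\<close> to \<open>S'\<close> matches subsets of equal size.
  The terms of proper subsets cancel, which leaves only the full sets.\<close>

lemma sum_Pow_diff:
  fixes N g :: "_ \<Rightarrow> real" and S S' :: "'n::finite set"
  assumes "card S = m" "card S' = m"
    and N: "\<And>V V'. card V = card V' \<Longrightarrow> card V < m \<Longrightarrow> N V = N V'"
  shows "(\<Sum>V\<in>Pow S. g (card V) * N V) - (\<Sum>V\<in>Pow S'. g (card V) * N V)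
    = g m * (N S - N S')"
proof -
  obtain f where f: "bij_betw f S S'"
    using assms(1,2) by (metis finite finite_same_card_bij)
  have c: "card (f ` V) = card V" if "V \<in> Pow S" for V
    using f that by (auto simp: bij_betw_def intro!: card_image intro: inj_on_subset)
  have "(\<Sum>V\<in>Pow S'. g (card V) * N V) = (\<Sum>V\<in>Pow S. g (card V) * N (f ` V))"
    using c by (subst sum.reindex_bij_betw[OF bij_betw_Pow[OF f], symmetric]) simp
  then have "(\<Sum>V\<in>Pow S. g (card V) * N V) - (\<Sum>V\<in>Pow S'. g (card V) * N V)
      = (\<Sum>V\<in>Pow S. g (card V) * (N V - N (f ` V)))"
    by (simp add: sum_subtractf right_diff_distrib)
  also have "\<dots> = (\<Sum>V\<in>{S}. g (card V) * (N V - N (f ` V)))"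
  proof (intro sum.mono_neutral_right ballI)
    fix V assume V: "V \<in> Pow S - {S}"
    then have "card V < m"
      using assms(1) by (metis DiffE PowD finite psubsetI psubset_card_mono singletonI)
    then have "N V = N (f ` V)" using c V by (intro N) auto
    then show "g (card V) * (N V - N (f ` V)) = 0" by simp
  qed auto
  also have "\<dots> = g m * (N S - N S')"
    using f assms(1) by (simp add: bij_betw_def)
  finally show ?thesis .
qed

text \<open>In the first two cases no codeword of weight \<open>u\<close> covers a set of size
  \<open>m\<close>; \<open>0 < m\<close> excludes the zero word. In the third, every support meets
  every set of size \<open>m\<close>, and inclusion-exclusion then determines the covering number
  from those of smaller sets.\<close>

lemma cover_count_eq_outside:
  fixes C :: "('a::{zero,finite} ^ 'n) set"
  assumes "card S = m" "card S' = m" "0 < m"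
    and IH: "\<forall>V V'. card V = card V' \<longrightarrow> card V < m \<longrightarrow> cover_count C u V = cover_count C u V'"
    and u: "u \<notin> nonzero_weights C \<or> u < m \<or> CARD('n) < u + m"
  shows "cover_count C u S = cover_count C u S'"
proof -
  consider "u \<notin> nonzero_weights C" | "u < m" | "CARD('n) < u + m" using u by auto
  then show ?thesis
  proof cases
    case 1
    have "cover_count C u R = 0" if "card R = m" for R
    proof -
      have "c \<noteq> 0" if "R \<subseteq> support c" for c :: "'a ^ 'n"
        using that \<open>card R = m\<close> \<open>0 < m\<close> by (auto simp: support_def)
      then have "{c \<in> codewords C u. R \<subseteq> support c} = {}"
        using 1 by (auto simp: nonzero_weights_def codewords_def)
      then show ?thesis by (simp add: cover_count_def)
    qed
    then show ?thesis using assms(1,2) by simp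
  next
    case 2
    have "cover_count C u R = 0" if "card R = m" for R
    proof -
      have "{c \<in> codewords C u. R \<subseteq> support c} = {}"
        using 2 that by (auto simp: codewords_def dest: card_le_wt)
      then show ?thesis by (simp add: cover_count_def)
    qed
    then show ?thesis using assms(1,2) by simp
  next
    case 3
    \<comment> \<open>The product is the indicator of a support disjoint from \<open>R\<close>, for
      which there is no room.\<close>
    have "(\<Sum>c\<in>codewords C u. \<Prod>i\<in>R. 1 + (if i \<in> support c then - 1 else 0 :: real)) = 0"
      if "card R = m" for R
    proof (intro sum.neutral ballI)
      fix c assume "c \<in> codewords C u"
      then have "card (support c) = u" by (simp add: codewords_def wt_def)
      then have "R \<inter> support c \<noteq> {}"
        using 3 that card_Un_disjoint[of R "support c"] card_mono[of UNIV "R \<union> support c"] by auto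
      then show "(\<Prod>i\<in>R. 1 + (if i \<in> support c then - 1 else 0 :: real)) = 0"
        by (auto intro!: prod_zero)
    qed
    from this[OF assms(1)] this[OF assms(2)]
    have "(\<Sum>V\<in>Pow S. (- 1) ^ card V * real (cover_count C u V))
        - (\<Sum>V\<in>Pow S'. (- 1) ^ card V * real (cover_count C u V)) = 0"
      unfolding sum_codewords_prod by simp
    moreover have "(\<Sum>V\<in>Pow S. (- 1) ^ card V * real (cover_count C u V))
        - (\<Sum>V\<in>Pow S'. (- 1) ^ card V * real (cover_count C u V))
        = (- 1) ^ m * (real (cover_count C u S) - real (cover_count C u S'))"
      using assms(1,2) by (rule sum_Pow_diff[where g = "\<lambda>k. (- 1) ^ k"]) (metis IH)
    ultimately show ?thesis by simp
  qed
qed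

lemma finite_nonzero_weights:
  fixes C :: "('a::{zero,finite} ^ 'n) set"
  shows "finite (nonzero_weights C)"
  by (simp add: nonzero_weights_def)

lemma wt_le: "wt (c :: 'a::zero ^ 'n) \<le> CARD('n)"
  by (simp add: wt_def card_mono)

text \<open>Each position is given its generic factor \<open>1 + 2 y\<close> or
  \<open>1 - y\<close>. The correction on \<open>S\<close> is \<open>2 / (1 + 2 y)\<close> at zero
  entries and \<open>- 1 / (1 - y)\<close> at nonzero ones; writing it as \<open>a\<close> plus
  \<open>b\<close> on the support makes \<open>sum_codewords_prod\<close> applicable. The range of
  \<open>y\<close> keeps the denominators nonzero.\<close>

lemma poly_dual_cover_poly:
  fixes C :: "('a::{field,finite} ^ 'n) set" and y :: real
  assumes "CARD('a) = 3" "vec.subspace C" "0 < y" "y < 1"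
  shows "real (card C) * poly (dual_cover_poly C S) y
    = (\<Sum>u\<le>CARD('n). (1 + 2 * y) ^ (CARD('n) - u) * (1 - y) ^ u *
        (\<Sum>V\<in>Pow S. (2 / (1 + 2 * y)) ^ (card S - card V)
            * (- 3 / ((1 - y) * (1 + 2 * y))) ^ card V * real (cover_count C u V)))"
proof -
  let ?a = "2 / (1 + 2 * y)" and ?b = "- 3 / ((1 - y) * (1 + 2 * y))"
  have nz: "1 + 2 * y \<noteq> 0" "1 - y \<noteq> 0" using assms(3,4) by auto
  have ab: "?a + ?b = - 1 / (1 - y)"
  proof -
    have "2 / q = 2 * p / (p * q)" if "p \<noteq> 0" for p q :: real using that by simp
    then have "?a = 2 * (1 - y) / ((1 - y) * (1 + 2 * y))" using nz by blast
    then have "?a + ?b = (2 * (1 - y) + - 3) / ((1 - y) * (1 + 2 * y))"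
      by (simp only: add_divide_distrib)
    also have "2 * (1 - y) + - 3 = - 1 * (1 + 2 * y)" by simp
    also have "- 1 * (1 + 2 * y) / ((1 - y) * (1 + 2 * y)) = - 1 / (1 - y)"
      using nz(1) by (rule nonzero_mult_divide_mult_cancel_right)
    finally show ?thesis .
  qed
  have fac: "(\<Prod>i\<in>UNIV. if i \<in> S then (if c $ i = 0 then 2 else - 1)
         else (if c $ i = 0 then 1 + 2 * y else 1 - y))
      = (1 + 2 * y) ^ (CARD('n) - wt c) * (1 - y) ^ wt c
          * (\<Prod>i\<in>S. ?a + (if i \<in> support c then ?b else 0))" for c :: "'a ^ 'n"
  proof -
    have "(\<Prod>i\<in>UNIV. if i \<in> S then (if c $ i = 0 then 2 else - 1)
         else (if c $ i = 0 then 1 + 2 * y else 1 - y))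
       = (\<Prod>i\<in>UNIV. (if i \<in> support c then 1 - y else 1 + 2 * y)
           * (if i \<in> S then ?a + (if i \<in> support c then ?b else 0) else 1))"
    proof (intro prod.cong refl)
      fix i
      show "(if i \<in> S then (if c $ i = 0 then 2 else - 1)
           else (if c $ i = 0 then 1 + 2 * y else 1 - y))
         = (if i \<in> support c then 1 - y else 1 + 2 * y)
             * (if i \<in> S then ?a + (if i \<in> support c then ?b else 0) else 1)"
      proof (cases "i \<in> S \<and> c $ i \<noteq> 0")
        case True
        then have "i \<in> S" "c $ i \<noteq> 0" "i \<in> support c" by (simp_all add: support_def)
        moreover have "(1 - y) * (?a + ?b) = - 1" unfolding ab using nz by simp
        ultimately show ?thesis by (simp only: if_True if_False)
      next
        case False
        then show ?thesis using nz by (auto simp: support_def divide_eq_eq)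
      qed
    qed
    also have "\<dots> = (1 - y) ^ wt c * (1 + 2 * y) ^ card (- support c)
        * (\<Prod>i\<in>S. ?a + (if i \<in> support c then ?b else 0))"
      unfolding prod.distrib
      by (simp add: prod.If_cases wt_def)
    finally show ?thesis by (simp add: Compl_eq_Diff_UNIV card_Diff_subset wt_def mult.commute)
  qed
  have "real (card C) * poly (dual_cover_poly C S) y
      = real (card C) * (\<Sum>x\<in>{x \<in> dual_code C. S \<subseteq> support x}. y ^ (wt x - card S))"
    by (simp add: dual_cover_poly_def poly_sum poly_monom)
  also have "\<dots> = (\<Sum>c\<in>C. (1 + 2 * y) ^ (CARD('n) - wt c) * (1 - y) ^ wt c
          * (\<Prod>i\<in>S. ?a + (if i \<in> support c then ?b else 0)))"
    unfolding macwilliams_covering[OF assms(1,2)] fac ..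
  also have "\<dots> = (\<Sum>u\<le>CARD('n). \<Sum>c\<in>codewords C u.
      (1 + 2 * y) ^ (CARD('n) - wt c) * (1 - y) ^ wt c
          * (\<Prod>i\<in>S. ?a + (if i \<in> support c then ?b else 0)))"
    unfolding codewords_def using wt_le
    by (intro sum.group[symmetric]) auto
  also have "\<dots> = (\<Sum>u\<le>CARD('n). (1 + 2 * y) ^ (CARD('n) - u) * (1 - y) ^ u *
      (\<Sum>c\<in>codewords C u. \<Prod>i\<in>S. ?a + (if i \<in> support c then ?b else 0)))"
    by (intro sum.cong refl) (simp add: sum_distrib_left codewords_def)
  finally show ?thesis unfolding sum_codewords_prod .
qed

text \<open>
  Since \<open>2 / (1 + 2 y) + 1 / (1 - y) = 3 / ((1 - y) (1 + 2 y))\<close>, the only contribution of \<open>S\<close> not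
  already controlled by smaller sets is its own covering number, with a kernel polynomial.
\<close>

lemma dual_cover_poly_diff:
  fixes C :: "('a::{field,finite} ^ 'n) set"
  assumes "CARD('a) = 3" "vec.subspace C"
    and S: "card S = m" "card S' = m" "0 < m"
    and IH: "\<forall>u V V'. card V = card V' \<longrightarrow> card V < m \<longrightarrow>
      cover_count C u V = cover_count C u V'"
  shows "smult (real (card C)) (dual_cover_poly C S - dual_cover_poly C S')
    = (\<Sum>u\<in>{u \<in> nonzero_weights C. m \<le> u \<and> u + m \<le> CARD('n)}.
        smult ((- 3) ^ m * (real (cover_count C u S) - real (cover_count C u S')))
          (krawtchouk_poly (CARD('n) - m - u) (u - m)))"
    (is "?L = ?R")
proof -
  let ?n = "CARD('n)" and ?d = "\<lambda>u. real (cover_count C u S) - real (cover_count C u S')"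
  let ?U = "{u \<in> nonzero_weights C. m \<le> u \<and> u + m \<le> ?n}"
  \<comment> \<open>Evaluation in the open unit interval permits the divisions; agreement at
    infinitely many points then gives equality of polynomials.\<close>
  have eq: "poly ?L y = poly ?R y" if y: "0 < y" "y < 1" for y
  proof -
    let ?a = "2 / (1 + 2 * y)" and ?b = "- 3 / ((1 - y) * (1 + 2 * y))"
    have nz: "1 + 2 * y \<noteq> 0" "1 - y \<noteq> 0" using y by auto
    have "poly ?L y = real (card C) * poly (dual_cover_poly C S) y
        - real (card C) * poly (dual_cover_poly C S') y"
      by (simp add: algebra_simps)
    also have "\<dots> = (\<Sum>u\<le>?n. (1 + 2 * y) ^ (?n - u) * (1 - y) ^ u *
        ((\<Sum>V\<in>Pow S. (?a ^ (m - card V) * ?b ^ card V) * real (cover_count C u V))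
         - (\<Sum>V\<in>Pow S'. (?a ^ (m - card V) * ?b ^ card V) * real (cover_count C u V))))"
      unfolding poly_dual_cover_poly[OF assms(1,2) y] S
      by (simp only: sum_subtractf right_diff_distrib)
    also have "\<dots> = (\<Sum>u\<le>?n. (1 + 2 * y) ^ (?n - u) * (1 - y) ^ u *
        (?a ^ (m - m) * ?b ^ m * ?d u))"
    proof (intro sum.cong refl arg_cong[where f = "(*) _"])
      fix u
      show "(\<Sum>V\<in>Pow S. (?a ^ (m - card V) * ?b ^ card V) * real (cover_count C u V))
         - (\<Sum>V\<in>Pow S'. (?a ^ (m - card V) * ?b ^ card V) * real (cover_count C u V))
         = ?a ^ (m - m) * ?b ^ m * ?d u"
        using S(1,2) by (rule sum_Pow_diff[where g = "\<lambda>k. ?a ^ (m - k) * ?b ^ k"]) (metis IH)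
    qed
    also have "\<dots> = (\<Sum>u\<in>?U. (1 + 2 * y) ^ (?n - u) * (1 - y) ^ u *
        (?a ^ (m - m) * ?b ^ m * ?d u))"
    proof (intro sum.mono_neutral_right ballI)
      fix u assume "u \<in> {..?n} - ?U"
      then have "u \<notin> nonzero_weights C \<or> u < m \<or> ?n < u + m" by auto
      then have "?d u = 0"
        using cover_count_eq_outside[OF S IH[THEN spec]] by simp
      then show "(1 + 2 * y) ^ (?n - u) * (1 - y) ^ u * (?a ^ (m - m) * ?b ^ m * ?d u) = 0"
        by simp
    qed auto
    also have "\<dots> = (\<Sum>u\<in>?U. (- 3) ^ m * ?d u
        * ((1 + 2 * y) ^ (?n - m - u) * (1 - y) ^ (u - m)))"
    proof (intro sum.cong refl)
      fix u assume u: "u \<in> ?U"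
      \<comment> \<open>The denominators of \<open>?b ^ m\<close> lower both exponents by
        \<open>m\<close>. The truncated subtractions are exact for \<open>u\<close> in
        \<open>?U\<close>.\<close>
      have "(1 + 2 * y) ^ (?n - u) = (1 + 2 * y) ^ (?n - m - u) * (1 + 2 * y) ^ m"
        "(1 - y) ^ u = (1 - y) ^ (u - m) * (1 - y) ^ m"
        using u by (simp_all flip: power_add)
      moreover have "(- 3) ^ m = (1 + 2 * y) ^ m * (1 - y) ^ m * ?b ^ m"
      proof -
        have "q * p * (- 3 / (p * q)) = - 3" if "p \<noteq> 0" "q \<noteq> 0" for p q :: real
          using that by simp
        from this[OF nz(2,1)] show ?thesis unfolding power_mult_distrib[symmetric] by simp
      qed
      ultimately show "(1 + 2 * y) ^ (?n - u) * (1 - y) ^ u * (?a ^ (m - m) * ?b ^ m * ?d u)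
          = (- 3) ^ m * ?d u * ((1 + 2 * y) ^ (?n - m - u) * (1 - y) ^ (u - m))"
        by (simp only: diff_self_eq_0 power_0 mult_1 mult_ac)
    qed
    also have "\<dots> = poly ?R y"
      by (simp add: poly_sum poly_krawtchouk_poly)
    finally show ?thesis .
  qed
  have "poly (?L - ?R) y = 0" if "y \<in> {0<..<1}" for y
  proof -
    have "poly ?L y = poly ?R y" using that by (intro eq) simp_all
    then show ?thesis by (simp only: poly_diff diff_self)
  qed
  then have "{0<..<1} \<subseteq> {y. poly (?L - ?R) y = 0}" by blast
  then have "infinite {y. poly (?L - ?R) y = 0}"
    by (rule infinite_super) (simp add: infinite_Ioo)
  then have "?L - ?R = 0" using poly_roots_finite by blast
  then show ?thesis by (rule eq_iff_diff_eq_0[THEN iffD2])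
qed

section \<open>Vanishing moments and the Assmus--Mattson induction\<close>

lemma coeff_dual_cover_poly_eq_0:
  fixes C :: "('a::{field,finite} ^ 'n) set"
  assumes "is_min_weight (dual_code C) dperp" "0 < card S" "i + card S < dperp"
  shows "coeff (dual_cover_poly C S) i = 0"
proof -
  have "x \<noteq> 0" if "S \<subseteq> support x" for x :: "'a ^ 'n"
    using that assms(2) by (auto simp: support_def)
  then have "{x \<in> codewords (dual_code C) (i + card S). S \<subseteq> support x} = {}"
    using assms(1,3) by (force simp: is_min_weight_def nonzero_weights_def codewords_def)
  then show ?thesis by (simp add: coeff_dual_cover_poly cover_count_def)
qed

lemma cover_moments_eq_0:
  fixes C :: "('a::{field,finite} ^ 'n) set"
  assumes "CARD('a) = 3" "vec.subspace C" "is_min_weight (dual_code C) dperp"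
    and S: "card S = m" "card S' = m" "0 < m"
    and IH: "\<forall>u V V'. card V = card V' \<longrightarrow> card V < m \<longrightarrow>
      cover_count C u V = cover_count C u V'"
    and j: "j + m < dperp"
  shows "(\<Sum>u\<in>{u \<in> nonzero_weights C. m \<le> u \<and> u + m \<le> CARD('n)}.
    (real (cover_count C u S) - real (cover_count C u S')) * real u ^ j) = 0"
proof -
  let ?U = "{u \<in> nonzero_weights C. m \<le> u \<and> u + m \<le> CARD('n)}"
  let ?d = "\<lambda>u. real (cover_count C u S) - real (cover_count C u S')"
  have "(\<Sum>u\<in>?U. ((- 3) ^ m * ?d u) * real u ^ j) = 0"
  proof (rule moments_eq_0[where m = m and n = "CARD('n)" and r = "dperp - m"])
    fix i assume "i < dperp - m"
    then show "coeff (\<Sum>u\<in>?U. smult ((- 3) ^ m * ?d u)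
        (krawtchouk_poly (CARD('n) - m - u) (u - m))) i = 0"
      using coeff_dual_cover_poly_eq_0[OF assms(3)] S
      unfolding dual_cover_poly_diff[OF assms(1,2) S IH, symmetric]
      by simp
  qed (use j in auto)
  then show ?thesis
    by (simp add: mult.assoc flip: sum_distrib_left)
qed

text \<open>Strong induction on the size \<open>m\<close> of the sets. The weight bound assumed at
  \<open>t\<close> passes to every \<open>m\<close> up to \<open>t\<close>, so there are always at
  least as many vanishing moments as unknown differences.\<close>

lemma assmus_mattson_cover_count:
  fixes C :: "('a::{field,finite} ^ 'n) set"
  assumes "CARD('a) = 3" "vec.subspace C" "is_min_weight (dual_code C) dperp"
    and AM: "t + card {u \<in> nonzero_weights C. u + t \<le> CARD('n)} \<le> dperp"
    and "card S = card S'" "card S \<le> t"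
  shows "cover_count C u S = cover_count C u S'"
  using assms(5,6)
proof (induction "card S" arbitrary: u S S' rule: less_induct)
  case less
  define m where "m = card S"
  have S: "card S = m" "card S' = m" "m \<le> t" using less.prems by (simp_all add: m_def)
  have IH: "\<forall>u V V'. card V = card V' \<longrightarrow> card V < m \<longrightarrow>
      cover_count C u V = cover_count C u V'"
    using S(3) by (intro allI impI less.hyps) (simp_all add: m_def)
  show ?case
  proof (cases "m = 0")
    case True
    with S have "S = {}" "S' = {}" by simp_all
    then show ?thesis by simp
  next
    case False
    then have m: "0 < m" by simp
    let ?n = "CARD('n)"
    let ?U = "{u \<in> nonzero_weights C. m \<le> u \<and> u + m \<le> ?n}"
    let ?A = "{u \<in> nonzero_weights C. u + t \<le> ?n}"
    show ?thesis
    proof (cases "u \<in> ?U")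
      case True
      have fin: "finite ?A" "finite ?U" by (simp_all add: finite_nonzero_weights)
      \<comment> \<open>Passing from \<open>t\<close> down to \<open>m\<close> admits only the
        weights above \<open>n - t\<close> and at most \<open>n - m\<close>, hence at most
        \<open>t - m\<close> new ones, while \<open>dperp - m\<close> grows by
        \<open>t - m\<close>.\<close>
      have "?U \<subseteq> ?A \<union> {?n + 1 - t..<?n + 1 - m}" by auto
      then have "card ?U \<le> card (?A \<union> {?n + 1 - t..<?n + 1 - m})"
        using fin by (intro card_mono) auto
      also have "\<dots> \<le> card ?A + (t - m)"
        by (rule order_trans[OF card_Un_le]) simp
      finally have "card ?U \<le> dperp - m" using AM S(3) by simp
      then have "real (cover_count C u S) - real (cover_count C u S') = 0"
        using fin(2) True cover_moments_eq_0[OF assms(1-3) S(1,2) m IH]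
        by (intro eq_0_if_moments_eq_0[where U = ?U and r = "dperp - m"
              and \<delta> = "\<lambda>u. real (cover_count C u S) - real (cover_count C u S')"]) auto
      then show ?thesis by simp
    next
      case False
      then show ?thesis
        by (intro cover_count_eq_outside[OF S(1,2) m IH[THEN spec]]) auto
    qed
  qed
qed

text \<open>
  One size beyond the Assmus--Mattson range the vanishing moments leave a one-dimensional space
  for \<open>\<delta>\<close>. If some weight lies outside \<open>[t + 1, n - t - 1]\<close>, so that one of the exponents in
  \<^const>\<open>P_coeff\<close> is negative, then already \<open>\<delta> = 0\<close>.
\<close>

lemma dual_cover_count_diff:
  fixes C :: "('a::{field,finite} ^ 'n) set"
  assumes "CARD('a) = 3" "vec.subspace C" "is_min_weight (dual_code C) dperp"
    and AM: "t + card {u \<in> nonzero_weights C. u + t \<le> CARD('n)} = dperp"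
    and S: "card S = t + 1" "card S' = t + 1"
  obtains \<delta> :: "nat \<Rightarrow> real" where
    "\<And>j. j + t + 1 < dperp \<Longrightarrow>
      (\<Sum>u\<in>{u \<in> nonzero_weights C. u + t \<le> CARD('n)}. \<delta> u * real u ^ j) = 0"
    "\<And>w. real (cover_count (dual_code C) (w + t + 1) S)
        - real (cover_count (dual_code C) (w + t + 1) S')
      = (\<Sum>u\<in>{u \<in> nonzero_weights C. u + t \<le> CARD('n)}.
          \<delta> u * P_coeff (int CARD('n) - int u - (int t + 1)) (int u - (int t + 1)) w)"
proof -
  let ?n = "CARD('n)" and ?d = "\<lambda>u. real (cover_count C u S) - real (cover_count C u S')"
  let ?A = "{u \<in> nonzero_weights C. u + t \<le> ?n}"
  let ?U = "{u \<in> nonzero_weights C. t + 1 \<le> u \<and> u + (t + 1) \<le> ?n}"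
  define \<delta> where "\<delta> u = (- 3) ^ (t + 1) / real (card C) * ?d u" for u
  have IH: "\<forall>u V V'. card V = card V' \<longrightarrow> card V < t + 1 \<longrightarrow>
      cover_count C u V = cover_count C u V'"
    by (intro allI impI assmus_mattson_cover_count[OF assms(1-3) eq_imp_le[OF AM]]) simp_all
  have mom: "(\<Sum>u\<in>?U. ?d u * real u ^ j) = 0" if "j + t + 1 < dperp" for j
    using that by (intro cover_moments_eq_0[OF assms(1-3) S _ IH]) auto
  have "0 \<in> C" using assms(2) by (rule vec.subspace_0)
  then have cC: "card C \<noteq> 0" by auto
  have diff: "real (cover_count (dual_code C) (w + t + 1) S)
        - real (cover_count (dual_code C) (w + t + 1) S')
      = (\<Sum>u\<in>?U. \<delta> u * coeff (krawtchouk_poly (?n - (t + 1) - u) (u - (t + 1))) w)" for w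
  proof -
    have "real (card C) * (coeff (dual_cover_poly C S) w - coeff (dual_cover_poly C S') w)
        = coeff (smult (real (card C)) (dual_cover_poly C S - dual_cover_poly C S')) w"
      by simp
    also have "\<dots> = (\<Sum>u\<in>?U. (- 3) ^ (t + 1) * ?d u
        * coeff (krawtchouk_poly (?n - (t + 1) - u) (u - (t + 1))) w)"
      by (subst dual_cover_poly_diff[OF assms(1,2) S _ IH]) (simp_all add: coeff_sum)
    also have "\<dots> = real (card C) *
        (\<Sum>u\<in>?U. \<delta> u * coeff (krawtchouk_poly (?n - (t + 1) - u) (u - (t + 1))) w)"
      unfolding sum_distrib_left using cC by (intro sum.cong) (simp_all add: \<delta>_def)
    finally show ?thesis
      using cC S by (simp add: coeff_dual_cover_poly add.assoc)
  qed
  have fin: "finite ?A" "finite ?U" by (simp_all add: finite_nonzero_weights)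
  have sub: "?U \<subseteq> ?A" by auto
  show thesis
  proof (cases "?U = ?A")
    \<comment> \<open>All weights in \<open>?A\<close> now lie between \<open>t + 1\<close> and
      \<open>n - t - 1\<close>, so the integer arguments of \<open>P_coeff\<close> agree with the
      natural exponents of the kernels.\<close>
    case True
    show thesis
    proof (rule that[of \<delta>])
      fix j assume "j + t + 1 < dperp"
      then have "(\<Sum>u\<in>?U. \<delta> u * real u ^ j) = 0"
        using mom[of j] unfolding \<delta>_def mult.assoc sum_distrib_left[symmetric] by simp
      then show "(\<Sum>u\<in>?A. \<delta> u * real u ^ j) = 0" unfolding True .
    next
      fix w
      have "(\<Sum>u\<in>?U. \<delta> u * coeff (krawtchouk_poly (?n - (t + 1) - u) (u - (t + 1))) w)
          = (\<Sum>u\<in>?U. \<delta> u * P_coeff (int ?n - int u - (int t + 1)) (int u - (int t + 1)) w)"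
        by (intro sum.cong refl) (auto simp: coeff_krawtchouk_poly of_nat_diff algebra_simps)
      then show "real (cover_count (dual_code C) (w + t + 1) S)
          - real (cover_count (dual_code C) (w + t + 1) S')
        = (\<Sum>u\<in>?A. \<delta> u * P_coeff (int ?n - int u - (int t + 1)) (int u - (int t + 1)) w)"
        unfolding diff True .
    qed
  next
    case False
    with sub fin(1) have "card ?U < card ?A" by (intro psubset_card_mono) auto
    then have le: "card ?U \<le> dperp - (t + 1)" using AM by simp
    have "?d u = 0" if "u \<in> ?U" for u
      using fin(2) le that mom
      by (intro eq_0_if_moments_eq_0[where U = ?U and r = "dperp - (t + 1)" and \<delta> = ?d]) auto
    then have "\<delta> u = 0" if "u \<in> ?U" for u using that by (simp add: \<delta>_def)
    then have "real (cover_count (dual_code C) (w + t + 1) S)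
          - real (cover_count (dual_code C) (w + t + 1) S') = 0" for w
      unfolding diff by simp
    \<comment> \<open>With all differences zero, the zero function is a witness that satisfies both
      requirements, whatever \<open>P_coeff\<close> gives at negative arguments.\<close>
    then show thesis by (intro that[of "\<lambda>_. 0"]) simp_all
  qed
qed

section \<open>From constant covering numbers to designs\<close>

lemma is_t_design_support_design:
  fixes D :: "('a::{zero,finite} ^ 'n) set"
  assumes "codewords D v \<noteq> {}" "s \<le> v"
    and const: "\<And>S S'. card S = s \<Longrightarrow> card S' = s \<Longrightarrow> cover_count D v S = cover_count D v S'"
  shows "is_t_design s UNIV (support_design D v)"
proof -
  obtain x where x: "x \<in> codewords D v" using assms(1) by auto
  then have card: "card (support x) = v" by (simp add: codewords_def wt_def)
  \<comment> \<open>A subset of a support that occurs shows that the common covering number is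
    positive, as the design parameter must be.\<close>
  then obtain T where T: "T \<subseteq> support x" "card T = s"
    using assms(2) by (metis obtain_subset_with_card_n)
  have "x \<in> {c \<in> codewords D v. T \<subseteq> support c}" using x T by simp
  then have "{c \<in> codewords D v. T \<subseteq> support c} \<noteq> {}" by blast
  then have pos: "0 < cover_count D v T"
    by (simp add: cover_count_def card_gt_0_iff)
  have size: "size {#b \<in># support_design D v. S \<subseteq> b#} = cover_count D v S" for S
    by (simp add: support_design_def cover_count_def filter_mset_image_mset)
  have "\<forall>S. S \<subseteq> UNIV \<and> card S = s \<longrightarrow> cover_count D v S = cover_count D v T"
    using const T(2) by blast
  then have "is_t_design_with s v (cover_count D v T) UNIV (support_design D v)"
    unfolding is_t_design_with_def size
    using assms(2) pos card card_mono[of UNIV "support x"]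
    by (simp add: support_design_def codewords_def wt_def)
  then show ?thesis by (auto simp: is_t_design_def)
qed

text \<open>The AM-condition counts only the weights up to \<open>n - t\<close>. They form an
  initial segment of the sorted list of nonzero weights, which identifies them with
  \<open>d_1\<close>, \<open>d_2\<close>, ... in order.\<close>

lemma smallest_weights:
  fixes C :: "('a::{zero,finite} ^ 'n) set" and b t :: nat
  defines "A \<equiv> {u \<in> nonzero_weights C. u + t \<le> b}"
  shows "A = (\<lambda>l. nth_weight C (Suc l)) ` {..<card A}"
    and "i < j \<Longrightarrow> j < card A \<Longrightarrow> nth_weight C (Suc i) < nth_weight C (Suc j)"
proof -
  let ?W = "nonzero_weights C"
  let ?B = "{u \<in> ?W. \<not> u + t \<le> b}"
  have fin: "finite A" "finite ?B" "finite ?W"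
    by (simp_all add: A_def finite_nonzero_weights)
  have "sorted_list_of_set ?W = sorted_list_of_set A @ sorted_list_of_set ?B"
    using fin by (intro sorted_distinct_set_unique) (auto simp: A_def sorted_append)
  then have nth: "nth_weight C (Suc l) = sorted_list_of_set A ! l" if "l < card A" for l
    using that by (simp add: nth_weight_def nth_append)
  have "A = (!) (sorted_list_of_set A) ` {..<card A}"
    using fin(1) by (metis atLeast0LessThan length_sorted_list_of_set list.set_map map_nth
        set_sorted_list_of_set set_upt)
  then show "A = (\<lambda>l. nth_weight C (Suc l)) ` {..<card A}" using nth by simp
  show "nth_weight C (Suc i) < nth_weight C (Suc j)" if "i < j" "j < card A"
    using that nth strict_sorted_list_of_set[of A] by (simp add: sorted_wrt_iff_nth_less)
qed

theorem theorem1p4: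
  fixes C :: "('a::{field,finite} ^ 'n) set"
    and n k d dperp t :: nat
    and dl :: "nat \<Rightarrow> nat"
    and \<alpha> \<beta> :: "nat \<Rightarrow> int"
    and P :: "nat \<Rightarrow> nat \<Rightarrow> real"
  assumes code: "ternary_code C n k d"
    and dual: "is_min_weight (dual_code C) dperp"
    and AM: "AM_condition C dperp t"
    and dl_def: "\<And>l. dl l = nth_weight C l"
    and \<alpha>_def: "\<And>l. \<alpha> l = int n - int (dl l) - (int t + 1)"
    and \<beta>_def: "\<And>l. \<beta> l = int (dl l) - (int t + 1)"
    and P_def: "\<And>l w. P l w = P_coeff (\<alpha> l) (\<beta> l) w"
  shows
    "(int dperp - int t = 1 \<longrightarrow>
       (\<forall>w. P 1 w = 0 \<longrightarrow> codewords (dual_code C) (w + t + 1) \<noteq> {} \<longrightarrow>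
          is_t_design (t + 1) UNIV (support_design (dual_code C) (w + t + 1)))) \<and>
     (int dperp - int t = 2 \<longrightarrow>
       (\<forall>w. P 1 w - P 2 w = 0 \<longrightarrow> codewords (dual_code C) (w + t + 1) \<noteq> {} \<longrightarrow>
          is_t_design (t + 1) UNIV (support_design (dual_code C) (w + t + 1)))) \<and>
     (int dperp - int t = 3 \<longrightarrow>
       (\<forall>w. P 1 w
             - (real (dl 3) - real (dl 1)) / (real (dl 3) - real (dl 2)) * P 2 w
             + (real (dl 2) - real (dl 1)) / (real (dl 3) - real (dl 2)) * P 3 w = 0 \<longrightarrow>
          codewords (dual_code C) (w + t + 1) \<noteq> {} \<longrightarrow>
          is_t_design (t + 1) UNIV (support_design (dual_code C) (w + t + 1))))"
proof -
  have q: "CARD('a) = 3" and n: "CARD('n) = n" and sub: "vec.subspace C"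
    using code by (simp_all add: ternary_code_def)
  define A where "A = {u \<in> nonzero_weights C. u + t \<le> CARD('n)}"
  have "{u. codewords C u \<noteq> {} \<and> 0 < u \<and> int u \<le> int CARD('n) - int t} = A"
  proof -
    have "wt c = 0 \<longleftrightarrow> c = 0" for c :: "'a ^ 'n"
      by (auto simp: wt_def support_def vec_eq_iff)
    then show ?thesis
      by (force simp: A_def codewords_def nonzero_weights_def)
  qed
  then have AM': "t + card A = dperp"
    using AM by (simp add: AM_condition_def)
  have A: "A = (\<lambda>l. dl (Suc l)) ` {..<card A}"
    and less: "\<And>i j. i < j \<Longrightarrow> j < card A \<Longrightarrow> dl (Suc i) < dl (Suc j)"
    using smallest_weights[where C = C and t = t and b = "CARD('n)"] by (simp_all add: A_def dl_def)
  define Q where "Q w u = P_coeff (int n - int u - (int t + 1)) (int u - (int t + 1)) w" for w u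
  have P: "P l w = Q w (dl l)" for l w
    by (simp add: P_def \<alpha>_def \<beta>_def Q_def)
  \<comment> \<open>All three parts reduce to linear algebra: every \<open>\<delta>\<close> on
    \<open>A\<close> whose first \<open>card A - 1\<close> moments vanish must be orthogonal to
    \<open>Q w\<close>.\<close>
  have design: "is_t_design (t + 1) UNIV (support_design (dual_code C) (w + t + 1))"
    if ne: "codewords (dual_code C) (w + t + 1) \<noteq> {}"
      and van: "\<And>\<delta> :: nat \<Rightarrow> real. (\<And>j. j + 1 < card A \<Longrightarrow> (\<Sum>u\<in>A. \<delta> u * real u ^ j) = 0)
        \<Longrightarrow> (\<Sum>u\<in>A. \<delta> u * Q w u) = 0" for w
  proof (rule is_t_design_support_design[OF ne])
    fix S S' :: "'n set"
    assume S: "card S = t + 1" "card S' = t + 1"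
    obtain \<delta> :: "nat \<Rightarrow> real" where
      "\<And>j. j + t + 1 < dperp \<Longrightarrow> (\<Sum>u\<in>A. \<delta> u * real u ^ j) = 0"
      "\<And>w. real (cover_count (dual_code C) (w + t + 1) S)
          - real (cover_count (dual_code C) (w + t + 1) S') = (\<Sum>u\<in>A. \<delta> u * Q w u)"
      using dual_cover_count_diff[OF q sub dual AM'[unfolded A_def] S,
          folded A_def, unfolded n, folded Q_def] by blast
    with van[of \<delta>] AM' have "real (cover_count (dual_code C) (w + t + 1) S)
        - real (cover_count (dual_code C) (w + t + 1) S') = 0" by simp
    then show "cover_count (dual_code C) (w + t + 1) S = cover_count (dual_code C) (w + t + 1) S'"
      by simp
  qed simp
  show ?thesis
  proof (intro conjI impI allI)
    fix w
    assume "int dperp - int t = 1" and zero: "P 1 w = 0"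
      and ne: "codewords (dual_code C) (w + t + 1) \<noteq> {}"
    then have card: "card A = 1" using AM' by simp
    \<comment> \<open>With a single weight there is no moment condition, and the sum is a multiple
      of \<open>P 1 w\<close>.\<close>
    have "A = {dl 1}" by (subst A[unfolded card]) auto
    with zero show "is_t_design (t + 1) UNIV (support_design (dual_code C) (w + t + 1))"
      by (intro design[OF ne]) (simp add: P)
  next
    fix w
    assume "int dperp - int t = 2" and zero: "P 1 w - P 2 w = 0"
      and ne: "codewords (dual_code C) (w + t + 1) \<noteq> {}"
    then have card: "card A = 2" using AM' by simp
    have A2: "A = {dl 1, dl 2}"
      by (subst A[unfolded card]) (simp add: lessThan_Suc numeral_2_eq_2 insert_commute)
    have neq: "dl 1 \<noteq> dl 2" using less[of 0 1] card by (simp add: numeral_2_eq_2)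
    show "is_t_design (t + 1) UNIV (support_design (dual_code C) (w + t + 1))"
    proof (rule design[OF ne])
      fix \<delta> :: "nat \<Rightarrow> real"
      assume "\<And>j. j + 1 < card A \<Longrightarrow> (\<Sum>u\<in>A. \<delta> u * real u ^ j) = 0"
      \<comment> \<open>The zeroth moment alone makes \<open>\<delta>\<close> proportional to (1,
        -1).\<close>
      from this[of 0] have "\<delta> (dl 2) = - \<delta> (dl 1)" using A2 neq card by simp
      then show "(\<Sum>u\<in>A. \<delta> u * Q w u) = 0"
        using zero neq by (simp add: A2 P)
    qed
  next
    fix w
    assume "int dperp - int t = 3" and zero: "P 1 w
        - (real (dl 3) - real (dl 1)) / (real (dl 3) - real (dl 2)) * P 2 w
        + (real (dl 2) - real (dl 1)) / (real (dl 3) - real (dl 2)) * P 3 w = 0"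
      and ne: "codewords (dual_code C) (w + t + 1) \<noteq> {}"
    then have card: "card A = 3" using AM' by simp
    have A3: "A = {dl 1, dl 2, dl 3}"
      by (subst A[unfolded card])
        (simp add: lessThan_Suc numeral_2_eq_2 numeral_3_eq_3 insert_commute)
    have lt: "dl 1 < dl 2" "dl 2 < dl 3"
      using less[of 0 1] less[of 1 2] card by (simp_all add: numeral_2_eq_2 numeral_3_eq_3)
    have sum3: "(\<Sum>u\<in>A. f u) = f (dl 1) + f (dl 2) + f (dl 3)" for f :: "nat \<Rightarrow> real"
      using lt by (simp add: A3 add.assoc)
    show "is_t_design (t + 1) UNIV (support_design (dual_code C) (w + t + 1))"
    proof (rule design[OF ne])
      fix \<delta> :: "nat \<Rightarrow> real"
      assume mom: "\<And>j. j + 1 < card A \<Longrightarrow> (\<Sum>u\<in>A. \<delta> u * real u ^ j) = 0"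
      define e where "e = real (dl 3) - real (dl 2)"
      have e: "e \<noteq> 0" using lt by (simp add: e_def)
      have m0: "\<delta> (dl 1) + \<delta> (dl 2) + \<delta> (dl 3) = 0"
        using mom[of 0] card by (simp add: sum3)
      have m1: "\<delta> (dl 1) * dl 1 + \<delta> (dl 2) * dl 2 + \<delta> (dl 3) * dl 3 = 0"
        using mom[of 1] card by (simp add: sum3)
      \<comment> \<open>Eliminating one unknown at a time from the two moments makes
        \<open>\<delta>\<close> proportional to
        \<open>(d_3 - d_2, - (d_3 - d_1), d_2 - d_1)\<close>. Division by
        \<open>e = d_3 - d_2\<close> gives the coefficients of the hypothesis on
        \<open>w\<close>.\<close>
      have d2: "e * \<delta> (dl 2) = - \<delta> (dl 1) * (real (dl 3) - real (dl 1))"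
        using m0 m1 unfolding e_def by algebra
      have d3: "e * \<delta> (dl 3) = \<delta> (dl 1) * (real (dl 2) - real (dl 1))"
        using m0 m1 unfolding e_def by algebra
      have z: "e * P 1 w - (real (dl 3) - real (dl 1)) * P 2 w
          + (real (dl 2) - real (dl 1)) * P 3 w = 0"
      proof -
        have "e * p - x * q + y * r = e * (p - x / e * q + y / e * r)" for p q r x y :: real
          using e by (simp add: ring_distribs)
        then show ?thesis using zero unfolding e_def[symmetric] by simp
      qed
      have "e * (\<Sum>u\<in>A. \<delta> u * Q w u)
          = e * \<delta> (dl 1) * P 1 w + e * \<delta> (dl 2) * P 2 w + e * \<delta> (dl 3) * P 3 w"
        by (simp add: sum3 P algebra_simps)
      also have "\<dots> = \<delta> (dl 1) * (e * P 1 w - (real (dl 3) - real (dl 1)) * P 2 w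
          + (real (dl 2) - real (dl 1)) * P 3 w)"
        unfolding d2 d3 by (simp add: algebra_simps)
      finally show "(\<Sum>u\<in>A. \<delta> u * Q w u) = 0" using z e by simp
    qed
  qed
qed

end
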